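(* Let $n\ge 1$ and let $T$ be a $2$-triangulation on the half-cylinder $\mathcal{C}_n$, which lifts to $\overline{T}=\pi^{-1}(T)$ on the universal cover $\overline{\mathcal{C}}_n$. Then any $2$-relevant angle $\angle(u,v,w)$ in $\overline{T}$ belongs to a unique $2$-star in $\overline{T}$ (that is, there is a unique $2$-star all of whose edges lie in $\overline{T}$ and which has both $[u,v]$ and $[v,w]$ among its edges).
   Context: **Half-cylinder and universal cover.** $\mathcal{C}_n$ is the annulus with $n$ marked points on one of its boundary components (and none on the other). Its universal cover $\overline{\mathcal{C}}_n$ has vertices $\alpha_i$, $i\in\mathbb{Z}$ (the lifts of the marked points, in order along the boundary line); the covering map $\pi$ sends $\alpha_i$ to the marked point indexed by $i \bmod n$. Write $\alpha_i+j=\alpha_{i+j}$, $\alpha_j-\alpha_i=j-i$, and $\alpha_i<\alpha_j$ iff $i<j$. An edge of $\overline{\mathcal{C}}_n$ is an isotopy class of curves joining two distinct vertices $u,v$; it is determined by the unordered pair and denoted $[u,v]=[v,u]$. Its length is $|v-u|$. Put $[u,v]+j=[u+j,v+j]$; a translation of $e$ is an edge $e+\ell n$ with $\ell\in\mathbb{Z}$. An edge of $\mathcal{C}_n$ is a projection $\pi(e)$, with $\pi(e)=\pi(f)$ iff $f$ is a translation of $e$; the length of $\pi(e)$ is the length of $e$. **Cyclic order.** $x_0\prec x_1\prec\cdots\prec x_m$ means that the vertices are distinct and occur in this counterclockwise cyclic order, i.e. some cyclic rotation of the list $(x_0,\dots,x_m)$ is strictly increasing for $<$. **Crossings.** Two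 edges of $\overline{\mathcal{C}}_n$ intersect iff they can be written $[a_1,b_1]$, $[a_2,b_2]$ with $a_1\prec a_2\prec b_1\prec b_2$. A $3$-crossing is a set of three pairwise intersecting edges. **$2$-triangulations.** A $2$-triangulation on $\mathcal{C}_n$ is an inclusion-maximal set $T$ of edges of $\mathcal{C}_n$ such that $\pi^{-1}(T)$ contains no $3$-crossing. Convention: edges of length $<2$ (which never occur in a $3$-crossing) are disregarded, i.e. only edges of length $\ge 2$ are considered. An edge is $2$-relevant if its length $\ell$ satisfies $2<\ell\le 2n$. **Angles.** An angle $\angle(u,v,w)$ of $\overline{T}$ is given by a pair of edges $[u,v],[v,w]\in\overline{T}$ with $u\prec v\prec w$ such that there is no edge $[v,w_0]\in\overline{T}$ with $w_0\prec u\prec v\prec w$. It is $2$-relevant if at least one of $[u,v]$, $[v,w]$ is $2$-relevant with length $<2n$. **$2$-stars.** A $2$-star on vertices $z_0\prec z_1\prec z_2\prec z_3\prec z_4$ of $\overline{\mathcal{C}}_n$ consists of these vertices and the five edges $[z_i,z_{i+2}]$, with indices modulo $5$. *)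

theory Defs
  imports Main
begin

text \<open>
  The vertex \<open>\<alpha>\<^sub>i\<close> of the universal cover is represented by the integer \<open>i\<close>, and the edge
  \<open>[u,v]\<close> by the two-element set \<open>{u,v}\<close>.  An edge of the half-cylinder with \<open>n\<close> marked points
  is represented by the full fibre of the covering map over it, that is, by an orbit of edges
  under translation by multiples of \<open>n\<close>.
\<close>

type_synonym edge = "int set"
type_synonym cyl_edge = "edge set"

definition is_edge :: "edge \<Rightarrow> bool" where
  "is_edge e \<longleftrightarrow> (\<exists>u v. u \<noteq> v \<and> e = {u, v})"

definition edge_length :: "edge \<Rightarrow> int" where
  "edge_length e = Max e - Min e"

lemma edge_length_pair [simp]: "edge_length {u, v} = \<bar>v - u\<bar>"
  by (simp add: edge_length_def max_def min_def)

definition shift_edge :: "int \<Rightarrow> edge \<Rightarrow> edge" where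
  "shift_edge j e = (\<lambda>x. x + j) ` e"

definition proj_edge :: "nat \<Rightarrow> edge \<Rightarrow> cyl_edge" where
  "proj_edge n e = {shift_edge (l * int n) e | l. True}"

text \<open>Edges of length less than \<open>2\<close> are disregarded throughout.\<close>

definition cyl_edges :: "nat \<Rightarrow> cyl_edge set" where
  "cyl_edges n = {proj_edge n e | e. is_edge e \<and> 2 \<le> edge_length e}"

definition lift :: "nat \<Rightarrow> cyl_edge set \<Rightarrow> edge set" where
  "lift n T = {e. is_edge e \<and> proj_edge n e \<in> T}"

definition cyclic_order :: "int list \<Rightarrow> bool" where
  "cyclic_order xs \<longleftrightarrow> (\<exists>k. sorted_wrt (<) (rotate k xs))"

definition intersecting :: "edge \<Rightarrow> edge \<Rightarrow> bool" where
  "intersecting e f \<longleftrightarrow>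
     (\<exists>a1 b1 a2 b2. e = {a1, b1} \<and> f = {a2, b2} \<and> cyclic_order [a1, a2, b1, b2])"

definition three_crossing :: "edge set \<Rightarrow> bool" where
  "three_crossing X \<longleftrightarrow>
     card X = 3 \<and> (\<forall>e\<in>X. is_edge e) \<and> (\<forall>e\<in>X. \<forall>f\<in>X. e \<noteq> f \<longrightarrow> intersecting e f)"

definition three_crossing_free :: "nat \<Rightarrow> cyl_edge set \<Rightarrow> bool" where
  "three_crossing_free n T \<longleftrightarrow> \<not> (\<exists>X \<subseteq> lift n T. three_crossing X)"

definition two_triangulation :: "nat \<Rightarrow> cyl_edge set \<Rightarrow> bool" where
  "two_triangulation n T \<longleftrightarrow>
     T \<subseteq> cyl_edges n \<and> three_crossing_free n T \<and>
     (\<forall>T'. T' \<subseteq> cyl_edges n \<longrightarrow> three_crossing_free n T' \<longrightarrow> T \<subseteq> T' \<longrightarrow> T' = T)"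

definition two_relevant :: "nat \<Rightarrow> edge \<Rightarrow> bool" where
  "two_relevant n e \<longleftrightarrow> 2 < edge_length e \<and> edge_length e \<le> 2 * int n"

definition is_angle :: "edge set \<Rightarrow> int \<Rightarrow> int \<Rightarrow> int \<Rightarrow> bool" where
  "is_angle E u v w \<longleftrightarrow>
     {u, v} \<in> E \<and> {v, w} \<in> E \<and> cyclic_order [u, v, w] \<and>
     \<not> (\<exists>w0. {v, w0} \<in> E \<and> cyclic_order [w0, u, v, w])"

definition two_relevant_angle :: "nat \<Rightarrow> int \<Rightarrow> int \<Rightarrow> int \<Rightarrow> bool" where
  "two_relevant_angle n u v w \<longleftrightarrow>
     (\<exists>e \<in> {{u, v}, {v, w}}. two_relevant n e \<and> edge_length e < 2 * int n)"

text \<open>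
  A \<open>2\<close>-star is the pair of its vertex set and its edge set, so that the rotations of the
  list \<open>z\<^sub>0, \<dots>, z\<^sub>4\<close> name the same star.
\<close>

definition two_star :: "int set \<times> edge set \<Rightarrow> bool" where
  "two_star S \<longleftrightarrow>
     (\<exists>z. length z = 5 \<and> cyclic_order z \<and>
        S = (set z, {{z ! i, z ! ((i + 2) mod 5)} | i. i < 5}))"

end

theory Submission
  imports Defs
begin

text \<open>
  The first step is that, for an edge \<open>g\<close> of length at most \<open>2n\<close> outside the lift, two edges of the lift
  itself complete \<open>g\<close> to a 3-crossing.  Maximality only gives a 3-crossing that may use several
  translates of \<open>g\<close>; by the length bound there are at most two, \<open>g\<close> and \<open>g + n\<close>, and suitable
  translates of the third edge, or the edge \<open>[p, p + n]\<close> at the left end \<open>p\<close> of \<open>g\<close>, or two edges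
  obstructing it, yield a replacement.

  Given an angle \<open>(u, v, w)\<close>, the edge \<open>[v + 1, v - 1]\<close> belongs to the lift and crosses both sides
  of the angle.  Among the edges \<open>[s, t]\<close> doing so take an outermost one.  If \<open>[s, u]\<close> were missing,
  the two edges of the lift that block it would form a 3-crossing with one or two of \<open>[u, v]\<close>,
  \<open>[v, w]\<close>, \<open>[s, t]\<close>, or contradict the choice of \<open>[s, t]\<close> or the angle condition; \<open>[w, t]\<close> is the
  mirror image.  Hence \<open>v, s, w, u, t\<close> span a star.  Relevance of the angle ensures that \<open>[s, u]\<close> and
  \<open>[w, t]\<close> are not longer than \<open>2n\<close>.
\<close>

section \<open>Cyclic orders and the shape of a 3-crossing\<close>

text \<open>Rotation depends only on \<open>k mod length xs\<close>. The bound
  \<open>Suc (length xs - 1)\<close> keeps \<open>k = 0\<close> available for the empty list and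
  unfolds by \<open>lessThan_Suc\<close>.\<close>

lemma cyclic_order_iff_bounded:
  "cyclic_order xs \<longleftrightarrow> (\<exists>k\<in>{..<Suc (length xs - 1)}. sorted_wrt (<) (rotate k xs))"
proof (cases "xs = []")
  case False
  then have "k mod length xs < Suc (length xs - 1)" for k
    by simp
  then show ?thesis
    unfolding cyclic_order_def by (metis lessThan_iff rotate_conv_mod)
qed (simp add: cyclic_order_def)

lemma cyclic_order_3:
  "cyclic_order [a, b, c] \<longleftrightarrow> a < b \<and> b < c \<or> b < c \<and> c < a \<or> c < a \<and> a < b"
  unfolding cyclic_order_iff_bounded
  by (simp add: lessThan_Suc rotate_def) auto

lemma cyclic_order_4:
  "cyclic_order [a, b, c, d] \<longleftrightarrow>
     a < b \<and> b < c \<and> c < d \<or> b < c \<and> c < d \<and> d < a \<or>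
     c < d \<and> d < a \<and> a < b \<or> d < a \<and> a < b \<and> b < c"
  unfolding cyclic_order_iff_bounded
  by (simp add: lessThan_Suc rotate_def sorted_wrt1 sorted_wrt2 del: sorted_wrt.simps(2))
    (simp only: disj_ac)

lemma cyclic_order_5:
  "cyclic_order [a, b, c, d, e] \<longleftrightarrow>
     a < b \<and> b < c \<and> c < d \<and> d < e \<or> b < c \<and> c < d \<and> d < e \<and> e < a \<or>
     c < d \<and> d < e \<and> e < a \<and> a < b \<or> d < e \<and> e < a \<and> a < b \<and> b < c \<or>
     e < a \<and> a < b \<and> b < c \<and> c < d"
  unfolding cyclic_order_iff_bounded
  by (simp add: lessThan_Suc rotate_def sorted_wrt1 sorted_wrt2 del: sorted_wrt.simps(2))
    (simp only: disj_ac)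

lemma cyclic_order_6:
  "cyclic_order [a, b, c, d, e, f] \<longleftrightarrow>
     a < b \<and> b < c \<and> c < d \<and> d < e \<and> e < f \<or> b < c \<and> c < d \<and> d < e \<and> e < f \<and> f < a \<or>
     c < d \<and> d < e \<and> e < f \<and> f < a \<and> a < b \<or> d < e \<and> e < f \<and> f < a \<and> a < b \<and> b < c \<or>
     e < f \<and> f < a \<and> a < b \<and> b < c \<and> c < d \<or> f < a \<and> a < b \<and> b < c \<and> c < d \<and> d < e"
  unfolding cyclic_order_iff_bounded
  by (simp add: lessThan_Suc rotate_def sorted_wrt1 sorted_wrt2 del: sorted_wrt.simps(2))
    (simp only: disj_ac)

lemmas cyclic_order_iffs = cyclic_order_3 cyclic_order_4 cyclic_order_5 cyclic_order_6

lemma intersecting_iff: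
  assumes "a < b" "c < d"
  shows "intersecting {a, b} {c, d} \<longleftrightarrow> a < c \<and> c < b \<and> b < d \<or> c < a \<and> a < d \<and> d < b"
proof
  assume "intersecting {a, b} {c, d}"
  then show "a < c \<and> c < b \<and> b < d \<or> c < a \<and> a < d \<and> d < b"
    using assms unfolding intersecting_def cyclic_order_4
    by (auto simp: doubleton_eq_iff)
next
  assume "a < c \<and> c < b \<and> b < d \<or> c < a \<and> a < d \<and> d < b"
  then have "cyclic_order [a, c, b, d] \<or> cyclic_order [a, d, b, c]"
    using assms unfolding cyclic_order_4 by auto
  then show "intersecting {a, b} {c, d}"
    unfolding intersecting_def by (metis insert_commute)
qed

lemma is_edge_obtain_less:
  assumes "is_edge e"
  obtains a b where "a < b" "e = {a, b}"
  using assms unfolding is_edge_def by (metis insert_commute linorder_neqE)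

text \<open>Crossing edges have their left and right ends in the same order, so sorting by left ends
  fixes the order of all six.\<close>

lemma three_crossing_obtain:
  assumes "three_crossing X"
  obtains a b c a' b' c' where "a < b" "b < c" "c < a'" "a' < b'" "b' < c'"
    "X = {{a, a'}, {b, b'}, {c, c'}}"
proof -
  from assms obtain e f g where X: "X = {e, f, g}" and ne: "e \<noteq> f" "f \<noteq> g" "e \<noteq> g"
    unfolding three_crossing_def by (metis card_3_iff)
  with assms have ed: "is_edge e" "is_edge f" "is_edge g"
    and int: "intersecting e f" "intersecting f g" "intersecting e g"
    unfolding three_crossing_def by auto
  obtain e1 e2 f1 f2 g1 g2 where lt: "e1 < e2" "f1 < f2" "g1 < g2"
    and eq: "e = {e1, e2}" "f = {f1, f2}" "g = {g1, g2}"
    using ed by (meson is_edge_obtain_less)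
  have cr: "e1 < f1 \<and> f1 < e2 \<and> e2 < f2 \<or> f1 < e1 \<and> e1 < f2 \<and> f2 < e2"
    "f1 < g1 \<and> g1 < f2 \<and> f2 < g2 \<or> g1 < f1 \<and> f1 < g2 \<and> g2 < f2"
    "e1 < g1 \<and> g1 < e2 \<and> e2 < g2 \<or> g1 < e1 \<and> e1 < g2 \<and> g2 < e2"
    using int lt unfolding eq by (simp_all add: intersecting_iff)
  consider "e1 < f1" "f1 < g1" | "e1 < g1" "g1 < f1" | "f1 < e1" "e1 < g1"
    | "f1 < g1" "g1 < e1" | "g1 < e1" "e1 < f1" | "g1 < f1" "f1 < e1"
    using cr by linarith
  then show thesis
  proof cases
    case 1 then show ?thesis using that[of e1 f1 g1 e2 f2 g2] cr unfolding X eq by auto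
  next
    case 2 then show ?thesis using that[of e1 g1 f1 e2 g2 f2] cr unfolding X eq by auto
  next
    case 3 then show ?thesis using that[of f1 e1 g1 f2 e2 g2] cr unfolding X eq by auto
  next
    case 4 then show ?thesis using that[of f1 g1 e1 f2 g2 e2] cr unfolding X eq by auto
  next
    case 5 then show ?thesis using that[of g1 e1 f1 g2 e2 f2] cr unfolding X eq by auto
  next
    case 6 then show ?thesis using that[of g1 f1 e1 g2 f2 e2] cr unfolding X eq by auto
  qed
qed

lemma three_crossing_intro:
  assumes "a < b" "b < c" "c < a'" "a' < b'" "b' < c'"
  shows "three_crossing {{a, a'}, {b, b'}, {c, c'}}"
proof -
  have "card {{a, a'}, {b, b'}, {c, c'}} = 3"
    using assms by (auto simp: card_insert_if doubleton_eq_iff)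
  moreover have "is_edge {a, a'}" "is_edge {b, b'}" "is_edge {c, c'}"
    using assms unfolding is_edge_def by (metis less_trans less_irrefl)+
  ultimately show ?thesis
    using assms unfolding three_crossing_def by (auto simp: intersecting_iff)
qed

section \<open>Translation and the lift of a triangulation\<close>

lemma shift_edge_shift_edge: "shift_edge i (shift_edge j e) = shift_edge (i + j) e"
  unfolding shift_edge_def by (force simp: image_image algebra_simps)

lemma shift_edge_pair: "shift_edge j {a, b} = {a + j, b + j}"
  by (simp add: shift_edge_def)

lemma proj_edge_eq_iff:
  "proj_edge n e = proj_edge n f \<longleftrightarrow> (\<exists>l. e = shift_edge (l * int n) f)"
proof
  assume "proj_edge n e = proj_edge n f"
  moreover have "e \<in> proj_edge n e"
    unfolding proj_edge_def shift_edge_def by (auto intro!: exI[of _ 0])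
  ultimately show "\<exists>l. e = shift_edge (l * int n) f"
    unfolding proj_edge_def by auto
next
  assume "\<exists>l. e = shift_edge (l * int n) f"
  then obtain l where l: "e = shift_edge (l * int n) f" by blast
  have "shift_edge (k * int n) e = shift_edge ((k + l) * int n) f" for k
    unfolding l by (simp add: shift_edge_shift_edge algebra_simps)
  moreover have "shift_edge (k * int n) f = shift_edge ((k - l) * int n) e" for k
    unfolding l by (simp add: shift_edge_shift_edge algebra_simps)
  ultimately show "proj_edge n e = proj_edge n f"
    unfolding proj_edge_def by blast
qed

lemma pair_in_lift_iff: "{a, b} \<in> lift n T \<longleftrightarrow> a \<noteq> b \<and> proj_edge n {a, b} \<in> T"
  unfolding lift_def is_edge_def by (auto simp: doubleton_eq_iff)

lemma pair_in_lift_translate: "{a + l * int n, b + l * int n} \<in> lift n T \<longleftrightarrow> {a, b} \<in> lift n T"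
proof -
  have "proj_edge n {a + l * int n, b + l * int n} = proj_edge n {a, b}"
    unfolding proj_edge_eq_iff by (metis shift_edge_pair)
  then show ?thesis by (simp add: pair_in_lift_iff)
qed

lemma two_triangulation_edge_length:
  assumes "two_triangulation n T" "{a, b} \<in> lift n T"
  shows "2 \<le> \<bar>b - a\<bar>"
proof -
  have "proj_edge n {a, b} \<in> cyl_edges n"
    using assms unfolding two_triangulation_def pair_in_lift_iff by blast
  then obtain e where e: "is_edge e" "2 \<le> edge_length e" "proj_edge n e = proj_edge n {a, b}"
    unfolding cyl_edges_def by auto
  then obtain l where "e = shift_edge (l * int n) {a, b}"
    unfolding proj_edge_eq_iff by blast
  with e(2) show ?thesis by (simp add: shift_edge_pair)
qed

lemma two_triangulation_no_crossing:
  assumes "two_triangulation n T"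
    and "{a, a'} \<in> lift n T" "{b, b'} \<in> lift n T" "{c, c'} \<in> lift n T"
  shows "\<not> (a < b \<and> b < c \<and> c < a' \<and> a' < b' \<and> b' < c')"
  using assms three_crossing_intro[of a b c a' b' c']
  unfolding two_triangulation_def three_crossing_free_def
  by (metis empty_subsetI insert_subset)

text \<open>Inserting the orbit of \<open>{p, q}\<close> creates a 3-crossing, and the only edges it
  adds to the lift are translates of \<open>{p, q}\<close>.\<close>

lemma two_triangulation_maximal:
  assumes "two_triangulation n T" "p < q" "2 \<le> q - p" "{p, q} \<notin> lift n T"
  obtains a b c a' b' c' where "a < b" "b < c" "c < a'" "a' < b'" "b' < c'"
    and "{a, a'} \<in> lift n T \<or> (\<exists>l. a = p + l * int n \<and> a' = q + l * int n)"
    and "{b, b'} \<in> lift n T \<or> (\<exists>l. b = p + l * int n \<and> b' = q + l * int n)"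
    and "{c, c'} \<in> lift n T \<or> (\<exists>l. c = p + l * int n \<and> c' = q + l * int n)"
proof -
  let ?T = "insert (proj_edge n {p, q}) T"
  have "is_edge {p, q}" "2 \<le> edge_length {p, q}"
    using assms(2,3) unfolding is_edge_def by (metis less_irrefl, simp)
  then have "proj_edge n {p, q} \<in> cyl_edges n"
    unfolding cyl_edges_def by blast
  moreover have "?T \<noteq> T"
    using assms by (auto simp: pair_in_lift_iff)
  ultimately have "\<not> three_crossing_free n ?T"
    using assms(1) unfolding two_triangulation_def by (metis insert_subset subset_insertI)
  then obtain X where X: "X \<subseteq> lift n ?T" "three_crossing X"
    unfolding three_crossing_free_def by blast
  obtain a b c a' b' c' where lt: "a < b" "b < c" "c < a'" "a' < b'" "b' < c'"
    and eq: "X = {{a, a'}, {b, b'}, {c, c'}}"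
    using X(2) by (rule three_crossing_obtain)
  have *: "{x, y} \<in> lift n T \<or> (\<exists>l. x = p + l * int n \<and> y = q + l * int n)"
    if "{x, y} \<in> X" "x < y" for x y
  proof (cases "{x, y} \<in> lift n T")
    case False
    have "{x, y} \<in> lift n ?T" using that X(1) by blast
    with False have "proj_edge n {x, y} = proj_edge n {p, q}"
      by (auto simp: pair_in_lift_iff)
    then obtain l where "{x, y} = {p + l * int n, q + l * int n}"
      unfolding proj_edge_eq_iff shift_edge_pair by blast
    with \<open>x < y\<close> \<open>p < q\<close> show ?thesis by (auto simp: doubleton_eq_iff)
  qed simp
  show thesis
    using that[OF lt] * lt eq by auto
qed

section \<open>Missing edges are blocked by edges already present\<close>

text \<open>Crossings are excluded in cyclic form, which is stable under rotating the six ends and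
  under reflection.\<close>

locale periodic_crossing_free =
  fixes n :: int and E :: "int \<Rightarrow> int \<Rightarrow> bool"
  assumes n_pos: "1 \<le> n"
    and sym: "E a b \<Longrightarrow> E b a"
    and shift: "E (a + n) (b + n) \<longleftrightarrow> E a b"
    and no_crossing: "E a d \<Longrightarrow> E b e \<Longrightarrow> E c f \<Longrightarrow> \<not> cyclic_order [a, b, c, d, e, f]"
begin

text \<open>The edges \<open>[a, c]\<close> and \<open>[b, d]\<close> complete \<open>[p, q]\<close>
  to a 3-crossing.\<close>

definition blocked :: "int \<Rightarrow> int \<Rightarrow> bool" where
  "blocked p q \<longleftrightarrow> (\<exists>a b c d. cyclic_order [p, a, b, q, c, d] \<and> E a c \<and> E b d)"

lemma blockedI: "E a c \<Longrightarrow> E b d \<Longrightarrow> cyclic_order [p, a, b, q, c, d] \<Longrightarrow> blocked p q"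
  unfolding blocked_def by blast

lemma translate: "E (a + l * n) (b + l * n) \<longleftrightarrow> E a b"
proof (induction l rule: int_induct[of _ 0])
  case (step1 l)
  then show ?case using shift[of "a + l * n" "b + l * n"] by (simp add: algebra_simps)
next
  case (step2 l)
  then show ?case using shift[of "a + (l - 1) * n" "b + (l - 1) * n"] by (simp add: algebra_simps)
qed simp

lemma translate_2: "E (a + 2 * n) (b + 2 * n) \<longleftrightarrow> E a b"
  using translate[of a 2 b] by simp

lemma translate_uminus: "E (a - n) (b - n) \<longleftrightarrow> E a b" "E (a - 2 * n) (b - 2 * n) \<longleftrightarrow> E a b"
  using translate[of a "-1" b] translate[of a "-2" b] by simp_all

text \<open>A longer edge would form a 3-crossing with its translates by \<open>n\<close> and
  \<open>2 * n\<close>.\<close>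

lemma length_le:
  assumes "E a b"
  shows "\<bar>b - a\<bar> \<le> 2 * n"
proof -
  have *: "b - a \<le> 2 * n" if "E a b" for a b
  proof (rule ccontr)
    assume "\<not> b - a \<le> 2 * n"
    then have "cyclic_order [a, a + n, a + 2 * n, b, b + n, b + 2 * n]"
      using n_pos unfolding cyclic_order_6 by smt
    then show False
      using no_crossing that shift translate_2 by metis
  qed
  show ?thesis using *[of a b] *[of b a] assms sym by fastforce
qed

lemma blocked_translate:
  assumes "blocked (p + l * n) (q + l * n)"
  shows "blocked p q"
proof -
  obtain a b c d where *: "cyclic_order [p + l * n, a, b, q + l * n, c, d]" "E a c" "E b d"
    using assms unfolding blocked_def by blast
  have "cyclic_order [p, a - l * n, b - l * n, q, c - l * n, d - l * n]"
    using *(1) unfolding cyclic_order_6 by smt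
  moreover have "E (a - l * n) (c - l * n)" "E (b - l * n) (d - l * n)"
    using * translate[of _ "- l"] by simp_all
  ultimately show ?thesis by (rule blockedI[rotated 2])
qed

lemma blocked_sym: "blocked p q \<Longrightarrow> blocked q p"
proof -
  assume "blocked p q"
  then obtain a b c d where *: "cyclic_order [p, a, b, q, c, d]" "E a c" "E b d"
    unfolding blocked_def by blast
  have "cyclic_order [q, c, d, p, a, b]"
    using *(1) unfolding cyclic_order_6 by smt
  with * sym show ?thesis by (blast intro: blockedI)
qed

text \<open>One edge \<open>[c, d]\<close> completes \<open>[p, q]\<close> and
  \<open>[p + n, q + n]\<close> to a 3-crossing; the disjuncts put it first, second or third among
  the left ends.\<close>

definition crosses_two_translates :: "int \<Rightarrow> int \<Rightarrow> bool" where
  "crosses_two_translates p q \<longleftrightarrow> n < q - p \<and>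
     (\<exists>c d. E c d \<and> (c < p \<and> p + n < d \<and> d < q \<or> p < c \<and> c < p + n \<and> q < d \<and> d < q + n \<or>
        p + n < c \<and> c < q \<and> q + n < d))"

text \<open>Count the translates of \<open>[p, q]\<close> in the crossing: none contradicts
  \<open>no_crossing\<close>, one gives \<open>blocked\<close>, two give the other alternative, and
  three cannot occur.\<close>

lemma blocked_or_crosses_two_translates:
  assumes "p < q" "q - p \<le> 2 * n"
    and lt: "a < b" "b < c" "c < a'" "a' < b'" "b' < c'"
    and a: "E a a' \<or> (\<exists>l. a = p + l * n \<and> a' = q + l * n)"
    and b: "E b b' \<or> (\<exists>l. b = p + l * n \<and> b' = q + l * n)"
    and c: "E c c' \<or> (\<exists>l. c = p + l * n \<and> c' = q + l * n)"
  shows "blocked p q \<or> crosses_two_translates p q"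
proof -
  \<comment> \<open>Crossing translates differ by a positive multiple of \<open>n\<close> below
    \<open>q - p\<close>, hence below \<open>2 * n\<close>, so by \<open>n\<close> exactly.\<close>
  have succ: "m = l + 1" if "x = p + l * n" "x' = q + l * n" "y = p + m * n" "x < y" "y < x'" for x x' y l m
  proof -
    have "0 < (m - l) * n" "(m - l) * n < 2 * n"
      using that assms by (auto simp: algebra_simps)
    then have "0 < m - l" "m - l < 2"
      using n_pos by (simp_all add: zero_less_mult_iff)
    then show ?thesis by linarith
  qed
  have crosses: "crosses_two_translates p q"
    if "E x y" and long: "n < q - p"
      and pos: "x < p + l * n \<and> p + l * n + n < y \<and> y < q + l * n
       \<or> p + l * n < x \<and> x < p + l * n + n \<and> q + l * n < y \<and> y < q + l * n + n
       \<or> p + l * n + n < x \<and> x < q + l * n \<and> q + l * n + n < y" for x y l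
  proof -
    have "E (x - l * n) (y - l * n)"
      using that translate[of x "- l" y] by simp
    moreover have "x - l * n < p \<and> p + n < y - l * n \<and> y - l * n < q
       \<or> p < x - l * n \<and> x - l * n < p + n \<and> q < y - l * n \<and> y - l * n < q + n
       \<or> p + n < x - l * n \<and> x - l * n < q \<and> q + n < y - l * n"
      using pos by linarith
    ultimately show ?thesis
      unfolding crosses_two_translates_def using long by blast
  qed
  have blk: "blocked p q" if "cyclic_order [x, d, e, y, f, g]" "E d f" "E e g"
      "x = p + l * n" "y = q + l * n" for x y d e f g l
    using that by (metis blockedI blocked_translate)
  note succ_n = distrib_right[of _ 1 n, unfolded mult_1]
  consider "E a a'" "E b b'" "E c c'"
    | l where "a = p + l * n" "a' = q + l * n" "E b b'" "E c c'"
    | l where "b = p + l * n" "b' = q + l * n" "E a a'" "E c c'"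
    | l where "c = p + l * n" "c' = q + l * n" "E a a'" "E b b'"
    | l m where "a = p + l * n" "a' = q + l * n" "b = p + m * n" "b' = q + m * n" "E c c'"
    | l m where "a = p + l * n" "a' = q + l * n" "c = p + m * n" "c' = q + m * n" "E b b'"
    | l m where "b = p + l * n" "b' = q + l * n" "c = p + m * n" "c' = q + m * n" "E a a'"
    | l m k where "a = p + l * n" "a' = q + l * n" "b = p + m * n" "b' = q + m * n"
        "c = p + k * n" "c' = q + k * n"
    using a b c by metis
  then show ?thesis
  proof cases
    case 1
    with no_crossing[of a a' b b' c c'] lt show ?thesis by (auto simp: cyclic_order_6)
  next
    case (2 l)
    have "cyclic_order [a, b, c, a', b', c']" using lt by (auto simp: cyclic_order_6)
    with 2 blk show ?thesis by metis
  next
    case (3 l)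
    have "cyclic_order [b, c, a', b', c', a]" using lt by (auto simp: cyclic_order_6)
    with 3 blk sym show ?thesis by metis
  next
    case (4 l)
    have "cyclic_order [c, a', b', c', a, b]" using lt by (auto simp: cyclic_order_6)
    with 4 blk sym show ?thesis by metis
  next
    case (5 l m)
    then have "m = l + 1" using succ[of a l a' b m] lt by linarith
    with 5 lt show ?thesis using crosses[of c c' l] by (auto simp: succ_n)
  next
    case (6 l m)
    then have "m = l + 1" using succ[of a l a' c m] lt by linarith
    with 6 lt show ?thesis using crosses[of b b' l] by (auto simp: succ_n)
  next
    case (7 l m)
    then have "m = l + 1" using succ[of b l b' c m] lt by linarith
    with 7 lt show ?thesis using crosses[of a a' l] by (auto simp: succ_n)
  next
    case (8 l m k)
    then have "m = l + 1" "k = l + 1"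
      using succ[of a l a' b m] succ[of a l a' c k] lt by linarith+
    with 8 lt show ?thesis by simp
  qed
qed

text \<open>The edge \<open>[p, p + n]\<close> crosses none of its translates, so maximality provides the last hypothesis.\<close>

lemma blocked_if_crosses_two_translates:
  assumes "crosses_two_translates p q" "q - p \<le> 2 * n"
    and base: "E p (p + n) \<or> blocked p (p + n)"
  shows "blocked p q"
proof -
  obtain c d where "n < q - p" and cd: "E c d"
    and "c < p \<and> p + n < d \<and> d < q \<or> p + n < c \<and> c < q \<and> q + n < d \<or>
      p < c \<and> c < p + n \<and> q < d \<and> d < q + n"
    using assms(1) unfolding crosses_two_translates_def by blast
  then consider "c < p" "p + n < d" "d < q" | "p + n < c" "c < q" "q + n < d"
    | "p < c" "c < p + n" "q < d" "d < q + n" by blast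
  then show ?thesis
  proof cases
    case 1
    \<comment> \<open>Here \<open>[c, d]\<close> and its translate by \<open>n\<close> block;
      \<open>p < c + n\<close> since \<open>d - c\<close> is at most \<open>2 * n\<close>.\<close>
    have "cyclic_order [p, c + n, d, q, d + n, c]"
      using 1 assms(2) length_le[OF cd] n_pos unfolding cyclic_order_6 by smt
    then show ?thesis using cd sym shift blockedI by metis
  next
    case 2
    have "cyclic_order [p, c - n, c, q, d - n, d]"
      using 2 n_pos unfolding cyclic_order_6 by smt
    then show ?thesis using cd translate_uminus blockedI by metis
  next
    case f: 3
    show ?thesis
    proof (cases "n < d - c")
      case True
      have "cyclic_order [p, c, d - n, q, d, c - n]"
        using f True n_pos unfolding cyclic_order_6 by smt
      then show ?thesis using cd sym translate_uminus blockedI by metis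
    next
      case short: False
      from base show ?thesis
      proof
        assume "E p (p + n)"
        then have "E (p + n) (p + 2 * n)"
          using shift[of p "p + n"] by (simp add: algebra_simps)
        \<comment> \<open>Shortness of \<open>[c, d]\<close> gives \<open>d < p + 2 * n\<close>, so
          \<open>[p + n, p + 2 * n]\<close> crosses it.\<close>
        moreover have "cyclic_order [p, c, p + n, q, d, p + 2 * n]"
          using f short \<open>n < q - p\<close> unfolding cyclic_order_6 by smt
        ultimately show ?thesis using cd blockedI by blast
      next
        assume "blocked p (p + n)"
        then obtain r r' s s' where cyc: "cyclic_order [p, r, r', p + n, s, s']"
          and rs: "E r s" "E r' s'"
          unfolding blocked_def by blast
        have r: "p < r" "r < r'" "r' < p + n"
          using cyc n_pos unfolding cyclic_order_6 by smt+
        \<comment> \<open>Both obstructing edges cross \<open>[p, q]\<close>, or both cross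
          \<open>[p + n, q + n]\<close>, or they separate; then one of them is paired with
          \<open>[c, d]\<close>, chosen by comparing \<open>c\<close> with
          \<open>r'\<close>.\<close>
        consider "cyclic_order [p, r, r', q, s, s']" | "cyclic_order [p + n, s, s', q + n, r, r']"
          | "p + n < s" "s \<le> q" "s' < p \<or> q + n \<le> s'"
          using cyc r f \<open>n < q - p\<close> n_pos unfolding cyclic_order_6 by smt
        then show ?thesis
        proof cases
          case 1
          then show ?thesis using rs blockedI by blast
        next
          case 2
          then have "blocked (p + n) (q + n)" using rs sym blockedI by blast
          then show ?thesis using blocked_translate[of p 1 q] by simp
        next
          case 3
          show ?thesis
          proof (cases "c < r'")
            case True
            have "cyclic_order [p, c, r', q, d, s']"
              using 3 True r f \<open>n < q - p\<close> unfolding cyclic_order_6 by smt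
            then show ?thesis using rs cd blockedI by blast
          next
            case False
            have "cyclic_order [p + n, s, d, q + n, r, c]"
              using 3 False r f unfolding cyclic_order_6 by smt
            then have "blocked (p + n) (q + n)" using rs cd sym blockedI by blast
            then show ?thesis using blocked_translate[of p 1 q] by simp
          qed
        qed
      qed
    qed
  qed
qed

end

section \<open>Reflection, angles and outermost cuts\<close>

lemma cyclic_order_uminus:
  fixes a b c d e f :: int
  shows "cyclic_order [- c, - b, - a] \<longleftrightarrow> cyclic_order [a, b, c]"
    and "cyclic_order [- d, - c, - b, - a] \<longleftrightarrow> cyclic_order [a, b, c, d]"
    and "cyclic_order [- e, - d, - c, - b, - a] \<longleftrightarrow> cyclic_order [a, b, c, d, e]"
    and "cyclic_order [- f, - e, - d, - c, - b, - a] \<longleftrightarrow> cyclic_order [a, b, c, d, e, f]"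
  unfolding cyclic_order_iffs by (simp_all only: neg_less_iff_less conj_ac disj_ac)

lemma cyclic_order_rotate:
  shows "cyclic_order [b, c, d, a] \<longleftrightarrow> cyclic_order [a, b, c, d]"
    and "cyclic_order [b, c, d, e, a] \<longleftrightarrow> cyclic_order [a, b, c, d, e]"
  unfolding cyclic_order_iffs by (simp_all only: conj_ac disj_ac)

text \<open>Maximality is stated with blocking edges from \<open>E\<close> itself;
  \<open>two_triangulation_periodic\<close> derives this for a lift.\<close>

locale periodic_triangulation = periodic_crossing_free +
  assumes length_ge: "E a b \<Longrightarrow> 2 \<le> \<bar>b - a\<bar>"
    and maximal: "2 \<le> \<bar>b - a\<bar> \<Longrightarrow> \<bar>b - a\<bar> \<le> 2 * n \<Longrightarrow> \<not> E a b \<Longrightarrow> blocked a b"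
begin

text \<open>Blocking needs two vertices on each side, but only \<open>v\<close> lies between
  \<open>v - 1\<close> and \<open>v + 1\<close>.\<close>

lemma length_two_edge: "E (v + 1) (v - 1)"
proof (rule ccontr)
  assume "\<not> E (v + 1) (v - 1)"
  then have "blocked (v + 1) (v - 1)"
    using maximal[of "v - 1" "v + 1"] n_pos by simp
  then show False
    unfolding blocked_def cyclic_order_6 by linarith
qed

lemma mirror: "periodic_triangulation n (\<lambda>a b. E (- a) (- b))"
proof -
  have shift': "E (- (a + n)) (- (b + n)) \<longleftrightarrow> E (- a) (- b)" for a b
    using translate_uminus(1)[of "- a" "- b"] by simp
  have no_crossing': "\<not> cyclic_order [a, b, c, d, e, f]"
    if "E (- a) (- d)" "E (- b) (- e)" "E (- c) (- f)" for a b c d e f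
    using no_crossing[of "- f" "- c" "- e" "- b" "- d" "- a"] sym that
    by (simp add: cyclic_order_uminus)
  interpret mirror: periodic_crossing_free n "\<lambda>a b. E (- a) (- b)"
    using n_pos sym shift' no_crossing' by unfold_locales auto
  have "mirror.blocked a b" if "blocked (- a) (- b)" for a b
  proof -
    obtain c d e f where *: "cyclic_order [- a, c, d, - b, e, f]" "E c e" "E d f"
      using \<open>blocked (- a) (- b)\<close> unfolding blocked_def by blast
    have "cyclic_order [a, - f, - e, b, - d, - c]"
      using *(1) unfolding cyclic_order_6 by smt
    with * sym show ?thesis by (intro mirror.blockedI[of "- f" "- d" "- e" "- c"]) auto
  qed
  then show ?thesis
    using length_ge maximal by unfold_locales (fastforce simp: abs_minus_commute)+
qed

definition angle_at :: "int \<Rightarrow> int \<Rightarrow> int \<Rightarrow> bool" where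
  "angle_at u v w \<longleftrightarrow> E u v \<and> E v w \<and> cyclic_order [u, v, w] \<and>
     (\<forall>x. E v x \<longrightarrow> \<not> cyclic_order [x, u, v, w])"

text \<open>The order makes \<open>[s, t]\<close> cross both sides of the angle and is also the
  vertex order of the star sought.\<close>

definition cuts :: "int \<Rightarrow> int \<Rightarrow> int \<Rightarrow> int \<Rightarrow> int \<Rightarrow> bool" where
  "cuts u v w s t \<longleftrightarrow> E s t \<and> cyclic_order [v, s, w, u, t]"

text \<open>\<open>[s', t']\<close> is farther from \<open>v\<close> than \<open>[s, t]\<close>, towards \<open>w\<close> and \<open>u\<close>.\<close>

definition beyond :: "int \<Rightarrow> int \<Rightarrow> int \<Rightarrow> int \<Rightarrow> int \<Rightarrow> bool" where
  "beyond v s t s' t' \<longleftrightarrow>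
     (s' = s \<or> cyclic_order [v, s, s']) \<and> (t' = t \<or> cyclic_order [v, t', t]) \<and> (s' \<noteq> s \<or> t' \<noteq> t)"

lemma beyond_asym: "beyond v s t s' t' \<Longrightarrow> \<not> beyond v s' t' s t"
  unfolding beyond_def cyclic_order_3 by smt

lemma beyond_trans: "beyond v s t s' t' \<Longrightarrow> beyond v s' t' s'' t'' \<Longrightarrow> beyond v s t s'' t''"
  unfolding beyond_def cyclic_order_3 by smt

definition outermost_cut :: "int \<Rightarrow> int \<Rightarrow> int \<Rightarrow> int \<Rightarrow> int \<Rightarrow> bool" where
  "outermost_cut u v w s t \<longleftrightarrow>
     cuts u v w s t \<and> (\<forall>s' t'. cuts u v w s' t' \<longrightarrow> \<not> beyond v s t s' t')"

lemma ex_outermost_cut: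
  assumes "angle_at u v w"
  shows "\<exists>s t. outermost_cut u v w s t"
proof -
  let ?P = "{(s, t). cuts u v w s t}" and ?R = "\<lambda>(s, t) (s', t'). beyond v s t s' t'"
  have len: "2 \<le> \<bar>w - v\<bar>" "\<bar>w - v\<bar> \<le> 2 * n" "2 \<le> \<bar>v - u\<bar>" "\<bar>v - u\<bar> \<le> 2 * n"
    and cyc: "cyclic_order [u, v, w]"
    using assms length_ge length_le unfolding angle_at_def by auto
  \<comment> \<open>In the linear order \<open>s\<close> lies between \<open>v\<close> and
    \<open>w\<close>, or \<open>t\<close> between \<open>u\<close> and \<open>v\<close>; so one end
    is within \<open>2 * n\<close> of \<open>v\<close> and the other within
    \<open>4 * n\<close>.\<close>
  have "?P \<subseteq> {v - 4 * n..v + 4 * n} \<times> {v - 4 * n..v + 4 * n}"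
  proof clarify
    fix s t assume "cuts u v w s t"
    then have "cyclic_order [v, s, w, u, t]" "\<bar>t - s\<bar> \<le> 2 * n"
      using length_le unfolding cuts_def by auto
    then show "s \<in> {v - 4 * n..v + 4 * n} \<and> t \<in> {v - 4 * n..v + 4 * n}"
      using len unfolding cyclic_order_5 atLeastAtMost_iff by smt
  qed
  then have "finite ?P"
    using finite_subset by blast
  moreover have "cyclic_order [v, v + 1, w, u, v - 1]"
    using len cyc unfolding cyclic_order_iffs by smt
  then have "(v + 1, v - 1) \<in> ?P"
    using length_two_edge unfolding cuts_def by blast
  moreover have "asymp_on ?P ?R"
    by (rule asymp_onI) (use beyond_asym in blast)
  moreover have "transp_on ?P ?R"
    by (rule transp_onI) (use beyond_trans in blast)
  ultimately obtain m where "m \<in> ?P" "\<forall>x\<in>?P. x \<noteq> m \<longrightarrow> \<not> ?R m x"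
    using Finite_Set.bex_max_element[of ?P ?R] by blast
  then show ?thesis
    unfolding outermost_cut_def by (cases m) (force simp: beyond_def)
qed

lemma outermost_cut_length_le:
  assumes angle: "angle_at u v w" and rel: "\<bar>v - u\<bar> < 2 * n \<or> \<bar>w - v\<bar> < 2 * n"
    and cut: "outermost_cut u v w s t"
  shows "\<bar>u - s\<bar> \<le> 2 * n"
proof (rule ccontr)
  assume long: "\<not> \<bar>u - s\<bar> \<le> 2 * n"
  have E: "E u v" "E v w" "E s t" and cyc: "cyclic_order [v, s, w, u, t]"
    using angle cut unfolding angle_at_def outermost_cut_def cuts_def by auto
  note len = E[THEN length_le]
  \<comment> \<open>The split is by where the cyclic list wraps around. In the second and third
    cases \<open>[s, u]\<close> lies under \<open>[v, u]\<close> or \<open>[s, t]\<close>.\<close>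
  consider "u < t" "t < v" "v < s" "s < w" | "v < s" "s < w" "w < u"
    | "s < w" "w < u" "u < t" | "w < u" "u < t" "t < v" "v < s"
    using cyc unfolding cyclic_order_5 by blast
  then show False
  proof cases
    case 1
    \<comment> \<open>A side of length \<open>2 * n\<close> has a translate leaving \<open>v\<close>
      in the other direction. Since the other side is shorter, it ends between \<open>w\<close> and
      \<open>u\<close>, against the angle condition.\<close>
    have "v - u \<noteq> 2 * n"
    proof
      assume "v - u = 2 * n"
      then have "E v (v + 2 * n)"
        using translate_2[of u v] E(1) by (simp add: algebra_simps)
      moreover have "cyclic_order [v + 2 * n, u, v, w]"
        using \<open>v - u = 2 * n\<close> rel len 1 unfolding cyclic_order_4 by smt
      ultimately show False using angle unfolding angle_at_def by blast
    qed
    moreover have "w - v \<noteq> 2 * n"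
    proof
      assume "w - v = 2 * n"
      then have "E v (v - 2 * n)"
        using translate_uminus(2)[of v w] E(2) sym by (simp add: algebra_simps)
      moreover have "cyclic_order [v - 2 * n, u, v, w]"
        using \<open>w - v = 2 * n\<close> rel len 1 unfolding cyclic_order_4 by smt
      ultimately show False using angle unfolding angle_at_def by blast
    qed
    \<comment> \<open>The crossing consists of \<open>[s, t]\<close>, \<open>[v, w]\<close> and
      \<open>[u, v]\<close> moved by \<open>2 * n\<close>.\<close>
    ultimately have "cyclic_order [t, v, u + 2 * n, s, w, v + 2 * n]"
      using 1 long len rel unfolding cyclic_order_6 by smt
    then show False
      using no_crossing E sym translate_2 by blast
  next
    case 2
    then show False using long len by linarith
  next
    case 3
    then show False using long len by linarith
  next
    case 4
    \<comment> \<open>Moved back by \<open>2 * n\<close>, with its ends exchanging roles,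
      \<open>[s, t]\<close> is a cut farther from \<open>v\<close>.\<close>
    have "cuts u v w (t - 2 * n) (s - 2 * n)"
      unfolding cuts_def cyclic_order_5 using E sym translate_uminus 4 long len by auto
    moreover have "beyond v s t (t - 2 * n) (s - 2 * n)"
      unfolding beyond_def cyclic_order_3 using 4 long len by auto
    ultimately show False
      using cut unfolding outermost_cut_def by blast
  qed
qed

lemma outermost_cut_edge_left:
  assumes angle: "angle_at u v w" and rel: "\<bar>v - u\<bar> < 2 * n \<or> \<bar>w - v\<bar> < 2 * n"
    and cut: "outermost_cut u v w s t"
  shows "E s u"
proof (rule ccontr)
  assume "\<not> E s u"
  have E: "E u v" "E v w" "E s t" and cyc: "cyclic_order [v, s, w, u, t]"
    using angle cut unfolding angle_at_def outermost_cut_def cuts_def by auto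
  have "2 \<le> \<bar>u - s\<bar>"
    using cyc unfolding cyclic_order_5 by smt
  then have "blocked s u"
    using maximal outermost_cut_length_le[OF assms] \<open>\<not> E s u\<close> by blast
  then obtain a b c d where cyc': "cyclic_order [s, a, b, u, c, d]" and E': "E a c" "E b d"
    unfolding blocked_def by blast
  \<comment> \<open>Otherwise \<open>c\<close> and \<open>d\<close> both lie from \<open>v\<close>
    on towards \<open>s\<close>, and \<open>[a, c]\<close>, \<open>[b, d]\<close>,
    \<open>[s, t]\<close> cross pairwise.\<close>
  have c: "cyclic_order [u, c, v]"
  proof (rule ccontr)
    assume "\<not> cyclic_order [u, c, v]"
    then have "cyclic_order [t, c, d, s, a, b]"
      using cyc cyc' unfolding cyclic_order_iffs by smt
    then show False
      using no_crossing E E' sym by blast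
  qed
  \<comment> \<open>Otherwise \<open>[a, c]\<close> is a cut: beyond \<open>[s, t]\<close> if
    \<open>c\<close> does not pass \<open>t\<close>, and in a 3-crossing with \<open>[s, t]\<close>
    and \<open>[v, w]\<close> if it does.\<close>
  have "\<not> cyclic_order [s, a, w]"
  proof
    assume "cyclic_order [s, a, w]"
    then have "cuts u v w a c" "c = t \<or> cyclic_order [v, c, t] \<or> cyclic_order [v, s, a, w, t, c]"
      "cyclic_order [v, s, a]" "a \<noteq> s"
      using cyc cyc' c E' unfolding cyclic_order_iffs cuts_def by smt+
    moreover have "\<not> cyclic_order [v, s, a, w, t, c]"
      using no_crossing E E' by blast
    ultimately show False
      using cut unfolding outermost_cut_def beyond_def by blast
  qed
  then have a: "a = w \<or> cyclic_order [w, a, u]"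
    using cyc cyc' unfolding cyclic_order_iffs by smt
  \<comment> \<open>Now \<open>b\<close> lies strictly between \<open>w\<close> and
    \<open>u\<close>. The edge \<open>[b, d]\<close> violates the angle condition, or crosses
    \<open>[v, w]\<close> and \<open>[s, t]\<close>, or crosses \<open>[u, v]\<close> and
    \<open>[a, c]\<close>.\<close>
  consider "d = v" | "cyclic_order [v, d, s]" | "cyclic_order [u, d, v]"
    using cyc cyc' unfolding cyclic_order_iffs by smt
  then show False
  proof cases
    case 1
    have "cyclic_order [b, u, v, w]"
      using cyc cyc' a unfolding cyclic_order_iffs by smt
    then show False
      using angle E' sym 1 unfolding angle_at_def by blast
  next
    case 2
    have "cyclic_order [v, d, s, w, b, t]"
      using cyc cyc' a 2 unfolding cyclic_order_iffs by smt
    then show False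
      using no_crossing E E' sym by blast
  next
    case 3
    have "cyclic_order [v, a, b, u, c, d]"
      using cyc cyc' a c 3 unfolding cyclic_order_iffs by smt
    then show False
      using no_crossing E E' sym by blast
  qed
qed

text \<open>Negation turns the angle into \<open>(- w, - v, - u)\<close> and the cut into
  \<open>[- t, - s]\<close>, so \<open>[w, t]\<close> takes the role of
  \<open>[s, u]\<close>.\<close>

lemma outermost_cut_edge_right:
  assumes angle: "angle_at u v w" and rel: "\<bar>v - u\<bar> < 2 * n \<or> \<bar>w - v\<bar> < 2 * n"
    and cut: "outermost_cut u v w s t"
  shows "E w t"
proof -
  interpret mirror: periodic_triangulation n "\<lambda>a b. E (- a) (- b)"
    by (rule mirror)
  have "cyclic_order [- v, s, - u, - w, t] \<longleftrightarrow> cyclic_order [v, - t, w, u, - s]" for s t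
    using cyclic_order_uminus(3)[of v "- s" u w "- t"] cyclic_order_rotate(2)[of "- t" w u "- s" v]
    by simp
  then have cuts: "mirror.cuts (- w) (- v) (- u) s t \<longleftrightarrow> cuts u v w (- t) (- s)" for s t
    unfolding mirror.cuts_def cuts_def using sym by blast
  have beyond: "mirror.beyond (- v) (- t) (- s) t' s' \<longleftrightarrow> beyond v s t (- s') (- t')" for s' t'
    unfolding mirror.beyond_def beyond_def cyclic_order_3 by smt
  have "cyclic_order [x, - w, - v, - u] \<longleftrightarrow> cyclic_order [- x, u, v, w]" for x
    using cyclic_order_uminus(2)[of w v u "- x"] cyclic_order_rotate(1)[of u v w "- x"]
      cyclic_order_rotate(1)[of "- w" "- v" "- u" x]
    by simp
  then have "mirror.angle_at (- w) (- v) (- u)"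
    using angle sym unfolding mirror.angle_at_def angle_at_def by (auto simp: cyclic_order_uminus)
  moreover have "mirror.outermost_cut (- w) (- v) (- u) (- t) (- s)"
    using cut unfolding mirror.outermost_cut_def outermost_cut_def cuts beyond by simp
  moreover have "\<bar>- v - - w\<bar> < 2 * n \<or> \<bar>- u - - v\<bar> < 2 * n"
    using rel by linarith
  ultimately have "E (- (- t)) (- (- w))"
    using mirror.outermost_cut_edge_left by blast
  then show ?thesis using sym by simp
qed

end

section \<open>From the half-cylinder to the periodic setting\<close>

lemma two_triangulation_periodic:
  assumes "1 \<le> n" and T: "two_triangulation n T"
  shows "periodic_triangulation (int n) (\<lambda>a b. {a, b} \<in> lift n T)"
proof -
  let ?E = "\<lambda>a b. {a, b} \<in> lift n T"
  interpret periodic_crossing_free "int n" ?E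
  proof
    show "\<not> cyclic_order [a, b, c, d, e, f]" if "?E a d" "?E b e" "?E c f" for a b c d e f
    proof -
      note * = two_triangulation_no_crossing[OF T]
      \<comment> \<open>Each of the six rotations of a cyclic crossing is a linear one, with some
        edges read backwards.\<close>
      have "?E d a" "?E e b" "?E f c"
        using that by (simp_all add: insert_commute)
      then show ?thesis
        using *[of a d b e c f] *[of b e c f d a] *[of c f d a e b]
          *[of d a e b f c] *[of e b f c a d] *[of f c a d b e] that
        unfolding cyclic_order_6 by blast
    qed
    show "?E (a + int n) (b + int n) \<longleftrightarrow> ?E a b" for a b
      using pair_in_lift_translate[of a 1] by simp
  qed (use assms in \<open>auto simp: insert_commute\<close>)
  have *: "blocked p q \<or> crosses_two_translates p q"
    if pq: "p < q" "2 \<le> q - p" "q - p \<le> 2 * int n" "\<not> ?E p q" for p q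
    by (rule two_triangulation_maximal[OF T pq(1,2,4)])
      (rule blocked_or_crosses_two_translates[OF pq(1,3)])
  have blocked: "blocked p q"
    if pq: "p < q" "2 \<le> q - p" "q - p \<le> 2 * int n" "\<not> ?E p q" for p q
  proof (cases "crosses_two_translates p q")
    case True
    then obtain c d where "int n < q - p" "c < p \<and> p + int n < d \<and> d < q
        \<or> p < c \<and> c < p + int n \<and> q < d \<and> d < q + int n
        \<or> p + int n < c \<and> c < q \<and> q + int n < d"
      unfolding crosses_two_translates_def by blast
    \<comment> \<open>Each alternative has an integer strictly between \<open>p\<close> and
      \<open>p + n\<close> or between \<open>p + n\<close> and \<open>q\<close>. Hence
      \<open>[p, p + n]\<close> is long enough for maximality.\<close>
    then have "2 \<le> n"
      using pq(3) \<open>1 \<le> n\<close> by linarith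
    moreover have "\<not> crosses_two_translates p (p + int n)"
      unfolding crosses_two_translates_def by simp
    ultimately have "?E p (p + int n) \<or> blocked p (p + int n)"
      using *[of p "p + int n"] by auto
    then show ?thesis
      using True pq(3) blocked_if_crosses_two_translates by blast
  qed (use * that in blast)
  show ?thesis
  proof
    show "2 \<le> \<bar>b - a\<bar>" if "?E a b" for a b
      using two_triangulation_edge_length[OF T that] .
    show "blocked a b" if "2 \<le> \<bar>b - a\<bar>" "\<bar>b - a\<bar> \<le> 2 * int n" "\<not> ?E a b" for a b
    proof (cases "a < b")
      case True
      then show ?thesis using blocked[of a b] that by simp
    next
      case False
      then have "blocked b a" using blocked[of b a] that by (simp add: insert_commute)
      then show ?thesis by (rule blocked_sym)
    qed
  qed
qed

section \<open>Stars at an angle and their uniqueness\<close>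

definition star_of :: "int \<Rightarrow> int \<Rightarrow> int \<Rightarrow> int \<Rightarrow> int \<Rightarrow> int set \<times> edge set" where
  "star_of a b c d e = ({a, b, c, d, e}, {{a, c}, {b, d}, {c, e}, {d, a}, {e, b}})"

lemma star_of_rotate: "star_of b c d e a = star_of a b c d e"
  unfolding star_of_def by auto

lemma two_star_iff:
  "two_star S \<longleftrightarrow> (\<exists>a b c d e. cyclic_order [a, b, c, d, e] \<and> S = star_of a b c d e)"
proof -
  have *: "(set [a, b, c, d, e], {{[a, b, c, d, e] ! i, [a, b, c, d, e] ! ((i + 2) mod 5)} | i. i < 5})
      = star_of a b c d e" for a b c d e
  proof -
    have "{f i | i. i < 5} = {f 0, f 1, f 2, f 3, f 4}" for f :: "nat \<Rightarrow> edge"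
      by (auto simp: numeral_eq_Suc less_Suc_eq)
    then show ?thesis unfolding star_of_def by simp
  qed
  have len: "length z = 5 \<longleftrightarrow> (\<exists>a b c d e. z = [a, b, c, d, e])" for z :: "int list"
    by (auto simp: numeral_eq_Suc length_Suc_conv)
  show ?thesis unfolding two_star_def len * [symmetric] by blast
qed

text \<open>Rotate \<open>v\<close> to the front. Its edges end at the third and fourth vertices,
  and the orientation of the angle tells \<open>w\<close> from \<open>u\<close>.\<close>

lemma two_star_at_angle:
  assumes "two_star S" "{u, v} \<in> snd S" "{v, w} \<in> snd S" "cyclic_order [u, v, w]"
  obtains s t where "cyclic_order [v, s, w, u, t]" "S = star_of v s w u t"
proof -
  obtain a b c d e where cyc: "cyclic_order [a, b, c, d, e]" and S: "S = star_of a b c d e"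
    using assms(1) unfolding two_star_iff by blast
  have "v \<in> {a, b, c, d, e}"
    using assms(2) unfolding S star_of_def by auto
  moreover have "cyclic_order [b, c, d, e, a]" "cyclic_order [c, d, e, a, b]"
    "cyclic_order [d, e, a, b, c]" "cyclic_order [e, a, b, c, d]"
    using cyc by (simp_all add: cyclic_order_rotate)
  moreover have "S = star_of b c d e a" "S = star_of c d e a b" "S = star_of d e a b c"
    "S = star_of e a b c d"
    using S by (simp_all only: star_of_rotate)
  ultimately obtain b c d e where cyc: "cyclic_order [v, b, c, d, e]" and S: "S = star_of v b c d e"
    using cyc S by blast
  have "distinct [v, b, c, d, e]"
    using cyc unfolding cyclic_order_5 by auto
  then have "u = c \<or> u = d" "w = c \<or> w = d"
    using assms(2,3) unfolding S star_of_def by (auto simp: doubleton_eq_iff)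
  moreover have "cyclic_order [c, v, d] \<Longrightarrow> False" "cyclic_order [x, v, x] \<Longrightarrow> False" for x
    using cyc unfolding cyclic_order_iffs by linarith+
  ultimately have "u = d" "w = c"
    using assms(4) by blast+
  with cyc S that show thesis by blast
qed

context periodic_crossing_free
begin

text \<open>If \<open>s\<close> preceded \<open>s'\<close>, then \<open>[v, w]\<close>,
  \<open>[s, u]\<close>, \<open>[s', t']\<close> would be a 3-crossing; if \<open>t\<close> preceded
  \<open>t'\<close>, then \<open>[u, v]\<close>, \<open>[s, t]\<close>, \<open>[w, t']\<close> would
  be one.\<close>

lemma star_at_angle_unique:
  assumes cyc: "cyclic_order [v, s, w, u, t]" "cyclic_order [v, s', w, u, t']"
    and E: "E u v" "E v w" "E s u" "E w t" "E s t" "E s' u" "E w t'" "E s' t'"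
  shows "s = s'" "t = t'"
proof -
  have "\<not> cyclic_order [v, x, x', w, u, y]" if "E x u" "E x' y" for x x' y
    using no_crossing[of v w x u x' y] that E(2) by blast
  moreover have "s = s' \<or> cyclic_order [v, s, s', w, u, t'] \<or> cyclic_order [v, s', s, w, u, t]"
    using cyc unfolding cyclic_order_5 cyclic_order_6 by smt
  ultimately show "s = s'" using E by blast
  have "\<not> cyclic_order [v, x, w, u, y, y']" if "E x y" "E w y'" for x y y'
    using no_crossing[of v u x y w y'] that E(1) sym by blast
  moreover have "t = t' \<or> cyclic_order [v, s, w, u, t, t'] \<or> cyclic_order [v, s', w, u, t', t]"
    using cyc unfolding cyclic_order_5 cyclic_order_6 by smt
  ultimately show "t = t'" using E by blast
qed

end

theorem theorem3p6:
  fixes n :: nat and T :: "cyl_edge set" and u v w :: int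
  assumes "n \<ge> 1"
    and "two_triangulation n T"
    and "is_angle (lift n T) u v w"
    and "two_relevant_angle n u v w"
  shows "\<exists>!S. two_star S \<and> snd S \<subseteq> lift n T \<and> {u, v} \<in> snd S \<and> {v, w} \<in> snd S"
proof -
  interpret periodic_triangulation "int n" "\<lambda>a b. {a, b} \<in> lift n T"
    using assms(1,2) by (rule two_triangulation_periodic)
  have angle: "angle_at u v w"
    using assms(3) unfolding is_angle_def angle_at_def by blast
  then have cyc: "cyclic_order [u, v, w]"
    unfolding angle_at_def by blast
  have rel: "\<bar>v - u\<bar> < 2 * int n \<or> \<bar>w - v\<bar> < 2 * int n"
    using assms(4) unfolding two_relevant_angle_def by auto
  obtain s t where cut: "outermost_cut u v w s t"
    using ex_outermost_cut[OF angle] by blast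
  have snd_star: "snd (star_of v s w u t) = {{v, w}, {s, u}, {w, t}, {u, v}, {s, t}}" for s t
    by (simp add: star_of_def insert_commute)
  have st: "cyclic_order [v, s, w, u, t]" "{s, t} \<in> lift n T"
    using cut unfolding outermost_cut_def cuts_def by auto
  have uv: "{u, v} \<in> lift n T" "{v, w} \<in> lift n T"
    using angle unfolding angle_at_def by auto
  have su: "{s, u} \<in> lift n T" "{w, t} \<in> lift n T"
    using outermost_cut_edge_left[OF angle rel cut] outermost_cut_edge_right[OF angle rel cut] .
  show ?thesis
  proof (rule ex1I[of _ "star_of v s w u t"])
    show "two_star (star_of v s w u t) \<and> snd (star_of v s w u t) \<subseteq> lift n T \<and>
        {u, v} \<in> snd (star_of v s w u t) \<and> {v, w} \<in> snd (star_of v s w u t)"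
      using st uv su unfolding snd_star two_star_iff by blast
  next
    fix S assume S: "two_star S \<and> snd S \<subseteq> lift n T \<and> {u, v} \<in> snd S \<and> {v, w} \<in> snd S"
    then obtain s' t' where "cyclic_order [v, s', w, u, t']" "S = star_of v s' w u t'"
      using two_star_at_angle cyc by blast
    moreover from this(2) S have "snd (star_of v s' w u t') \<subseteq> lift n T"
      by simp
    then have "{s', u} \<in> lift n T" "{w, t'} \<in> lift n T" "{s', t'} \<in> lift n T"
      unfolding snd_star by auto
    ultimately show "S = star_of v s w u t"
      using star_at_angle_unique[of v s w u t s' t'] st uv su by blast
  qed
qed

end
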